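(* Let $Z2$ denote the second Zagreb index of a tree, let $A_1$ denote the sum of the degrees of the vertices at level 1 of a rooted tree, and write $S(n)=S(\tau(n))$ for each of these statistics $S$, where $\tau(n)$ is the rooted tree with Matula number $n$. Then for every positive integer $n$, $$Z2(n)=\begin{cases}0, & \text{if } n=1;\\ Z2(t)+A_1(t)+\Omega(t)+1, & \text{if } n=p_t \text{ with } t\ge 1;\\ Z2(r)+Z2(s)+A_1(r)\Omega(s)+A_1(s)\Omega(r), & \text{if } n=rs \text{ with } r,s\ge 2.\end{cases}$$
   Context: For $m\ge 1$ let $p_m$ denote the $m$-th prime ($p_1=2,p_2=3,p_3=5,\dots$). For a positive integer $n$, $\Omega(n)$ is the number of prime divisors of $n$ counted with multiplicity. Rooted trees are finite and considered up to isomorphism of rooted trees. The Matula number $\mu(T)$ of a rooted tree $T$ is defined recursively: $\mu(T)=1$ for the one-vertex tree; otherwise, if $T_1,\dots,T_d$ are the subtrees rooted at the vertices adjacent to the root of $T$, then $\mu(T)=p_{\mu(T_1)}p_{\mu(T_2)}\cdots p_{\mu(T_d)}$. The map $\mu$ is a bijection from rooted trees to positive integers, and $\tau(n)$ denotes the rooted tree with Matula number $n$. Equivalently: $\tau(1)$ is the one-vertex tree; $\tau(p_t)$ is obtained from $\tau(t)$ by adding a new vertex, which becomes the root, joined by an edge to the root of $\tau(t)$; and, for $r,s\ge 2$, $\tau(rs)$ is obtained from $\tau(r)$ and $\tau(s)$ by identifying their roots. For a statistic $S$ on rooted trees, $S(n)$ means $S(\tau(n))$. The degree $\deg(i)$ of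 a vertex $i$ is the number of edges incident with $i$. The second Zagreb index of a tree is $\sum_{ij} \deg(i)\deg(j)$, the sum being over all edges $ij$. The level of a vertex is its distance from the root; $A_1(T)=\sum\deg(i)$ over all vertices $i$ of $T$ at level 1, with degrees taken in $T$. *)

theory Defs
  imports "HOL-Computational_Algebra.Primes" "HOL-Library.Infinite_Set"
begin

text \<open>The index starts at 1, i.e. \<open>nth_prime 1 = 2\<close>; the value at 0 is irrelevant.\<close>

definition nth_prime :: "nat \<Rightarrow> nat" where
  "nth_prime m = enumerate {p::nat. prime p} (m - 1)"

definition big_Omega :: "nat \<Rightarrow> nat" where
  "big_Omega n = size (prime_factorization n)"

text \<open>Undirected graphs with a distinguished vertex; an edge is the set of its two endpoints.\<close>

record 'a rooted_graph =
  verts :: "'a set"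
  edges :: "'a set set"
  root :: 'a

definition adj :: "'a set set \<Rightarrow> ('a \<times> 'a) set" where
  "adj E = {(u, v). {u, v} \<in> E}"

text \<open>A cycle is given by the cyclic list of its at least three, pairwise distinct vertices.\<close>

definition has_cycle :: "'a set set \<Rightarrow> bool" where
  "has_cycle E \<longleftrightarrow>
     (\<exists>xs. length xs \<ge> 3 \<and> distinct xs \<and>
        (\<forall>i<length xs. {xs ! i, xs ! (Suc i mod length xs)} \<in> E))"

definition rooted_tree :: "'a rooted_graph \<Rightarrow> bool" where
  "rooted_tree T \<longleftrightarrow>
     finite (verts T) \<and> root T \<in> verts T \<and>
     (\<forall>e\<in>edges T. e \<subseteq> verts T \<and> card e = 2) \<and>
     (\<forall>u\<in>verts T. \<forall>v\<in>verts T. (u, v) \<in> (adj (edges T))\<^sup>*) \<and>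
     \<not> has_cycle (edges T)"

definition deg :: "'a rooted_graph \<Rightarrow> 'a \<Rightarrow> nat" where
  "deg T v = card {e \<in> edges T. v \<in> e}"

text \<open>The relational power \<open>adj E ^^ k\<close> relates vertices joined by a walk of length \<open>k\<close>.\<close>

definition level :: "'a rooted_graph \<Rightarrow> 'a \<Rightarrow> nat" where
  "level T v = (LEAST k. (root T, v) \<in> adj (edges T) ^^ k)"

definition zagreb2 :: "'a rooted_graph \<Rightarrow> nat" where
  "zagreb2 T = (\<Sum>e\<in>edges T. \<Prod>v\<in>e. deg T v)"

definition level1_degrees :: "'a rooted_graph \<Rightarrow> nat" where
  "level1_degrees T = (\<Sum>v\<in>{v \<in> verts T. level T v = 1}. deg T v)"

definition root_nbrs :: "'a rooted_graph \<Rightarrow> 'a set" where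
  "root_nbrs T = {c \<in> verts T. {root T, c} \<in> edges T}"

text \<open>The subtree rooted at a neighbour \<open>c\<close> of the root: the connected component of \<open>c\<close>
  after removing the root.\<close>

definition branch :: "'a rooted_graph \<Rightarrow> 'a \<Rightarrow> 'a rooted_graph" where
  "branch T c =
     (let V = {v \<in> verts T - {root T}. (c, v) \<in> (adj {e \<in> edges T. root T \<notin> e})\<^sup>*}
      in \<lparr>verts = V, edges = {e \<in> edges T. e \<subseteq> V}, root = c\<rparr>)"

text \<open>For the one-vertex tree the product is empty, hence 1. The value outside rooted trees is
  a dummy.\<close>

function matula :: "'a rooted_graph \<Rightarrow> nat" where
  "matula T = (if rooted_tree T then \<Prod>c\<in>root_nbrs T. nth_prime (matula (branch T c)) else 0)"
  by auto
termination
proof (relation "measure (\<lambda>T. card (verts T))")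
  fix T :: "'a rooted_graph" and c
  assume "rooted_tree T"
  then have "finite (verts T)" "root T \<in> verts T"
    by (auto simp: rooted_tree_def)
  moreover have "verts (branch T c) \<subseteq> verts T - {root T}"
    by (auto simp: branch_def Let_def)
  ultimately show "(branch T c, T) \<in> measure (\<lambda>T. card (verts T))"
    by (auto intro!: psubset_card_mono)
qed auto

declare matula.simps [simp del]

text \<open>A representative of the isomorphism class of rooted trees with Matula number \<open>n\<close>. Every
  finite tree is isomorphic to one whose vertices are natural numbers, and the Matula number
  determines a rooted tree up to isomorphism, so for positive \<open>n\<close> isomorphism-invariant
  statistics do not depend on the choice.\<close>

definition tau :: "nat \<Rightarrow> nat rooted_graph" where
  "tau n = (SOME T. rooted_tree T \<and> matula T = n)"

definition Z2 :: "nat \<Rightarrow> nat" where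
  "Z2 n = zagreb2 (tau n)"

definition A1 :: "nat \<Rightarrow> nat" where
  "A1 n = level1_degrees (tau n)"

end

theory Submission
  imports Defs
begin

text \<open>Grafting a rooted tree \<open>U\<close> onto a disjoint rooted tree \<open>T\<close> means joining the root of \<open>U\<close> to
  the root of \<open>T\<close> by a new edge and keeping the root of \<open>T\<close>. This adds \<open>U\<close> to the branches of \<open>T\<close>
  and leaves the others alone, so the Matula number of the result is \<open>p\<^sub>t m\<close>, where \<open>m\<close> and \<open>t\<close> are
  the Matula numbers of \<open>T\<close> and \<open>U\<close> (\<open>matula_graft\<close>). Conversely, cutting off any branch presents
  a nontrivial rooted tree as a graft of two smaller ones (\<open>graft_prune_branch\<close>). Trees can thus
  be treated by induction over grafts, in step with the factorisation of Matula numbers.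

  Grafting raises the degree of each of the two roots by one and changes no other degree. In
  the sum defining the second Zagreb index, an edge from a root to a neighbour \<open>v\<close> therefore gains
  \<open>deg v\<close>; the old edges gain in total the level-1 degree sums of \<open>T\<close> and \<open>U\<close>, and the new edge
  contributes the product of the two raised root degrees (\<open>zagreb2_graft\<close>). As the root degree is
  the number of prime factors of the Matula number, this gives for all \<open>t, m \<ge> 1\<close>
  \<open>Z2 (p\<^sub>t m) = Z2 m + A1 m + Z2 t + A1 t + (\<Omega> m + 1) (\<Omega> t + 1)\<close> and
  \<open>A1 (p\<^sub>t m) = A1 m + \<Omega> t + 1\<close>.
  The case \<open>m = 1\<close> is the formula for primes, and induction on the prime factors of \<open>r\<close> yields the
  formula for \<open>r s\<close>.

  The functions \<open>Z2\<close> and \<open>A1\<close> refer to one chosen tree for each number, whereas these trees are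
  not literally grafts of each other. The choice does not matter: a statistic that agrees on
  all one-vertex trees and whose value on a graft depends only on its values on the two parts is a
  function of the Matula number (\<open>matula_determines_statistic\<close>). It applies here to the triple of Zagreb index, level-1 degree sum
  and root degree. Disjoint representatives to graft exist because every positive number is the
  Matula number of a tree inside any given infinite set of vertices (\<open>matula_surj\<close>).\<close>

section \<open>Rooted trees\<close>

lemma branch_sel:
  "verts (branch T c) =
     {v \<in> verts T - {root T}. (c, v) \<in> (adj {e \<in> edges T. root T \<notin> e})\<^sup>*}"
  "edges (branch T c) = {e \<in> edges T. e \<subseteq> verts (branch T c)}"
  "root (branch T c) = c"
  by (simp_all add: branch_def Let_def)

lemma adj_iff [simp]: "(u, v) \<in> adj E \<longleftrightarrow> {u, v} \<in> E"
  by (simp add: adj_def)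

lemma adj_mono: "E \<subseteq> F \<Longrightarrow> adj E \<subseteq> adj F"
  by (auto simp: adj_def)

lemma adj_rtrancl_sym: "(u, v) \<in> (adj E)\<^sup>* \<Longrightarrow> (v, u) \<in> (adj E)\<^sup>*"
  by (rule symD[OF sym_rtrancl]) (auto simp: sym_def insert_commute)

lemma rooted_tree_edgeE:
  assumes "rooted_tree T" "e \<in> edges T"
  obtains u v where "e = {u, v}" "u \<noteq> v" "u \<in> verts T" "v \<in> verts T"
proof -
  have "card e = 2" "e \<subseteq> verts T"
    using assms by (auto simp: rooted_tree_def)
  then show ?thesis
    using that by (auto simp: card_2_iff)
qed

text \<open>Connectivity only has to be checked from the root, since walks can be reversed.\<close>

lemma rooted_treeI:
  assumes "finite (verts T)" "root T \<in> verts T"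
    and "\<And>e. e \<in> edges T \<Longrightarrow> e \<subseteq> verts T \<and> card e = 2"
    and "\<And>v. v \<in> verts T \<Longrightarrow> (root T, v) \<in> (adj (edges T))\<^sup>*"
    and "\<not> has_cycle (edges T)"
  shows "rooted_tree T"
  unfolding rooted_tree_def
  using assms by (blast intro: rtrancl_trans adj_rtrancl_sym)

lemma
  assumes "rooted_tree T"
  shows rooted_tree_finite_verts: "finite (verts T)"
    and rooted_tree_root: "root T \<in> verts T"
    and rooted_tree_edge_subset: "e \<in> edges T \<Longrightarrow> e \<subseteq> verts T"
    and rooted_tree_edge_card: "e \<in> edges T \<Longrightarrow> card e = 2"
    and rooted_tree_connected:
      "u \<in> verts T \<Longrightarrow> v \<in> verts T \<Longrightarrow> (u, v) \<in> (adj (edges T))\<^sup>*"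
    and rooted_tree_acyclic: "\<not> has_cycle (edges T)"
    and rooted_tree_finite_edges: "finite (edges T)"
proof -
  show *: "finite (verts T)" "root T \<in> verts T" "e \<in> edges T \<Longrightarrow> e \<subseteq> verts T"
    "e \<in> edges T \<Longrightarrow> card e = 2" "\<not> has_cycle (edges T)"
    "u \<in> verts T \<Longrightarrow> v \<in> verts T \<Longrightarrow> (u, v) \<in> (adj (edges T))\<^sup>*"
    using assms unfolding rooted_tree_def by blast+
  have "edges T \<subseteq> Pow (verts T)"
    using assms by (auto simp: rooted_tree_def)
  then show "finite (edges T)"
    using *(1) finite_subset by blast
qed

lemma has_cycle_mono: "has_cycle E \<Longrightarrow> E \<subseteq> F \<Longrightarrow> has_cycle F"
  unfolding has_cycle_def by blast

lemma root_nbrs_iff: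
  assumes "rooted_tree T"
  shows "c \<in> root_nbrs T \<longleftrightarrow> {root T, c} \<in> edges T"
  using rooted_tree_edge_subset[OF assms] by (auto simp: root_nbrs_def)

lemma root_notin_root_nbrs: "rooted_tree T \<Longrightarrow> root T \<notin> root_nbrs T"
  by (auto simp: root_nbrs_iff dest: rooted_tree_edge_card)

section \<open>Grafting\<close>

definition graft :: "'a rooted_graph \<Rightarrow> 'a rooted_graph \<Rightarrow> 'a rooted_graph" where
  "graft T U = \<lparr>verts = verts T \<union> verts U,
     edges = insert {root T, root U} (edges T \<union> edges U), root = root T\<rparr>"

lemma graft_sel [simp]:
  "verts (graft T U) = verts T \<union> verts U"
  "edges (graft T U) = insert {root T, root U} (edges T \<union> edges U)"
  "root (graft T U) = root T"
  by (simp_all add: graft_def)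

text \<open>A property that is inherited by the cyclic successor spreads to all positions. Applied to the
  side of a cut, it says that a cyclic sequence meeting both sides must leave each of them.\<close>

lemma cyclic_closed:
  fixes P :: "nat \<Rightarrow> bool"
  assumes step: "\<And>i. i < n \<Longrightarrow> P i \<Longrightarrow> P (Suc i mod n)"
    and "i < n" "P i" "j < n"
  shows "P j"
proof -
  have "P ((i + k) mod n)" for k
  proof (induction k)
    case (Suc k)
    have "P (Suc ((i + k) mod n) mod n)"
      using Suc step assms(2) by simp
    then show ?case by (simp add: mod_Suc_eq)
  qed (use assms in simp)
  from this[of "j + n - i"] show ?thesis
    using assms by simp
qed

text \<open>Joining two disjoint acyclic graphs by one edge creates no cycle: a cycle would either stay on
  one side or cross the new edge in both directions, and the two crossings share both end
  points, which is impossible for at least three distinct vertices.\<close>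

lemma not_has_cycle_bridge:
  assumes E: "\<And>e. e \<in> E \<Longrightarrow> e \<subseteq> V" "\<not> has_cycle E"
    and F: "\<And>e. e \<in> F \<Longrightarrow> e \<subseteq> W" "\<not> has_cycle F"
    and disj: "V \<inter> W = {}" and xy: "x \<in> V" "y \<in> W"
  shows "\<not> has_cycle (insert {x, y} (E \<union> F))"
proof
  assume "has_cycle (insert {x, y} (E \<union> F))"
  then obtain xs where len: "length xs \<ge> 3" and dist: "distinct xs"
    and cyc: "\<And>i. i < length xs \<Longrightarrow>
      {xs ! i, xs ! (Suc i mod length xs)} \<in> insert {x, y} (E \<union> F)"
    unfolding has_cycle_def by blast
  let ?n = "length xs"
  let ?s = "\<lambda>i. Suc i mod ?n"
  have s: "?s i < ?n" for i using len by (intro mod_less_divisor) linarith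
  have VW: "xs ! i \<in> V \<or> xs ! i \<in> W" if "i < ?n" for i
    using cyc[OF that] E(1) F(1) xy by (auto simp: doubleton_eq_iff)
  show False
  proof (cases "(\<forall>i<?n. xs ! i \<in> V) \<or> (\<forall>i<?n. xs ! i \<in> W)")
    case True
    then have "(\<forall>i<?n. {xs ! i, xs ! ?s i} \<in> E) \<or> (\<forall>i<?n. {xs ! i, xs ! ?s i} \<in> F)"
    proof
      assume *: "\<forall>i<?n. xs ! i \<in> V"
      have "{xs ! i, xs ! ?s i} \<in> E" if "i < ?n" for i
        using cyc[OF that] * that s[of i] F(1)[of "{xs ! i, xs ! ?s i}"] disj xy
        by (auto simp: doubleton_eq_iff)
      then show ?thesis by blast
    next
      assume *: "\<forall>i<?n. xs ! i \<in> W"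
      have "{xs ! i, xs ! ?s i} \<in> F" if "i < ?n" for i
        using cyc[OF that] * that s[of i] E(1)[of "{xs ! i, xs ! ?s i}"] disj xy
        by (auto simp: doubleton_eq_iff)
      then show ?thesis by blast
    qed
    then show False
      using E(2) F(2) len dist unfolding has_cycle_def by blast
  next
    case False
    then obtain a b where ab: "a < ?n" "xs ! a \<in> V" "b < ?n" "xs ! b \<in> W"
      using VW by blast
    obtain i where i: "i < ?n" "xs ! i \<in> V" "xs ! ?s i \<notin> V"
      using cyclic_closed[of ?n "\<lambda>i. xs ! i \<in> V" a b] ab disj by blast
    obtain j where j: "j < ?n" "xs ! j \<in> W" "xs ! ?s j \<notin> W"
      using cyclic_closed[of ?n "\<lambda>i. xs ! i \<in> W" b a] ab disj by blast
    have "xs ! ?s i \<in> W" "xs ! ?s j \<in> V"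
      using VW s i j by blast+
    then have "{xs ! i, xs ! ?s i} = {x, y}" "{xs ! j, xs ! ?s j} = {x, y}"
      using cyc[OF i(1)] cyc[OF j(1)] i j disj E(1) F(1) by blast+
    then have "xs ! i = x" "xs ! ?s i = y" "xs ! j = y" "xs ! ?s j = x"
      using i j disj xy by (auto simp: doubleton_eq_iff)
    then have "?s i = j" "?s j = i"
      using dist i(1) j(1) s by (metis nth_eq_iff_index_eq)+
    \<comment> \<open>Two steps along the cycle return to the start, so its length divides 2.\<close>
    then have "(i + 2) mod ?n = i mod ?n"
      using i(1) by (metis add_2_eq_Suc' mod_Suc_eq mod_less)
    then show False
      using len i(1) by (auto simp: mod_if split: if_splits)
  qed
qed

text \<open>A walk cannot leave a set of vertices that no edge connects with the outside. This is why the
  two parts of a graft do not see each other once the root is removed.\<close>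

lemma rtrancl_adj_Un_left:
  assumes "(c, v) \<in> (adj (A \<union> B))\<^sup>*" "c \<in> V"
    and "\<And>e. e \<in> A \<Longrightarrow> e \<subseteq> V" "\<And>e. e \<in> B \<Longrightarrow> e \<inter> V = {}"
  shows "(c, v) \<in> (adj A)\<^sup>* \<and> v \<in> V"
  using assms(1)
proof (induction rule: rtrancl_induct)
  case (step u v)
  then have "{u, v} \<in> A"
    using assms(4)[of "{u, v}"] by auto
  then show ?case
    using step.IH assms(3)[of "{u, v}"] by (auto intro: rtrancl_into_rtrancl)
qed (use assms in simp)

locale graftable =
  fixes T U :: "'a rooted_graph"
  assumes T: "rooted_tree T" and U: "rooted_tree U" and disj: "verts T \<inter> verts U = {}"
begin

lemma root_neq: "root T \<noteq> root U"
  using disj rooted_tree_root[OF T] rooted_tree_root[OF U] by auto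

lemma roots_notin: "root T \<notin> verts U" "root U \<notin> verts T"
  using disj rooted_tree_root[OF T] rooted_tree_root[OF U] by auto

lemma edges_disjoint: "edges T \<inter> edges U = {}" "{root T, root U} \<notin> edges T \<union> edges U"
proof -
  show "edges T \<inter> edges U = {}"
    using disj by (blast elim: rooted_tree_edgeE[OF T] dest: rooted_tree_edge_subset[OF U])
  show "{root T, root U} \<notin> edges T \<union> edges U"
    using roots_notin rooted_tree_edge_subset[OF U] rooted_tree_edge_subset[OF T] by blast
qed

lemma rooted_tree_graft: "rooted_tree (graft T U)"
proof (rule rooted_treeI)
  show "finite (verts (graft T U))" "root (graft T U) \<in> verts (graft T U)"
    using T U by (auto simp: rooted_tree_def)
  show "e \<subseteq> verts (graft T U) \<and> card e = 2" if "e \<in> edges (graft T U)" for e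
    using that T U root_neq by (auto simp: rooted_tree_def card_2_iff)
  let ?R = "(adj (edges (graft T U)))\<^sup>*"
  have sub: "(adj (edges T))\<^sup>* \<subseteq> ?R" "(adj (edges U))\<^sup>* \<subseteq> ?R"
    by (auto intro!: rtrancl_mono adj_mono)
  have "(root T, root U) \<in> ?R" by auto
  then show "(root (graft T U), v) \<in> ?R" if "v \<in> verts (graft T U)" for v
    using that sub rooted_tree_connected[OF T rooted_tree_root[OF T], of v]
      rooted_tree_connected[OF U rooted_tree_root[OF U], of v]
    unfolding graft_sel(1,3) by (blast intro: rtrancl_trans)
  show "\<not> has_cycle (edges (graft T U))"
    using not_has_cycle_bridge[of "edges T" "verts T" "edges U" "verts U"] T U disj
    by (auto simp: rooted_tree_def)
qed

lemma root_nbrs_graft: "root_nbrs (graft T U) = insert (root U) (root_nbrs T)"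
proof -
  have "{root T, v} \<notin> edges U" for v
    using roots_notin rooted_tree_edge_subset[OF U, of "{root T, v}"] by auto
  then show ?thesis
    by (auto simp: root_nbrs_iff[OF T] root_nbrs_iff[OF rooted_tree_graft] doubleton_eq_iff)
qed

lemma edges_graft_avoiding_root:
  "{e \<in> edges (graft T U). root T \<notin> e} = {e \<in> edges T. root T \<notin> e} \<union> edges U"
  using roots_notin rooted_tree_edge_subset[OF U] by auto

text \<open>Without the root of \<open>T\<close>, the new edge is gone and \<open>U\<close> is a whole component.\<close>

lemma branch_graft_root: "branch (graft T U) (root U) = U"
proof -
  have *: "(root U, v) \<in> (adj ({e \<in> edges T. root T \<notin> e} \<union> edges U))\<^sup>* \<longleftrightarrow> v \<in> verts U" for v
  proof
    assume "(root U, v) \<in> (adj ({e \<in> edges T. root T \<notin> e} \<union> edges U))\<^sup>*"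
    then have "(root U, v) \<in> (adj (edges U \<union> {e \<in> edges T. root T \<notin> e}))\<^sup>*"
      by (simp add: Un_commute)
    then show "v \<in> verts U"
      using rtrancl_adj_Un_left[of "root U" v "edges U" "{e \<in> edges T. root T \<notin> e}" "verts U"]
        disj rooted_tree_edge_subset[OF T] rooted_tree_edge_subset[OF U] rooted_tree_root[OF U]
      by blast
  next
    assume "v \<in> verts U"
    then have "(root U, v) \<in> (adj (edges U))\<^sup>*"
      using rooted_tree_connected[OF U rooted_tree_root[OF U]] by blast
    then show "(root U, v) \<in> (adj ({e \<in> edges T. root T \<notin> e} \<union> edges U))\<^sup>*"
      by (rule rev_subsetD) (auto intro!: rtrancl_mono adj_mono)
  qed
  have V: "verts (branch (graft T U) (root U)) = verts U"
    unfolding branch_sel using edges_graft_avoiding_root * roots_notin by auto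
  have "edges (branch (graft T U) (root U)) = edges U"
    unfolding branch_sel(2) V using disj roots_notin rooted_tree_edge_subset[OF U]
    by (auto elim!: rooted_tree_edgeE[OF T])
  then show ?thesis
    using V by (simp add: rooted_graph.equality branch_sel(3))
qed

lemma branch_graft:
  assumes "c \<in> root_nbrs T"
  shows "branch (graft T U) c = branch T c"
proof -
  let ?A = "{e \<in> edges T. root T \<notin> e}"
  have c: "c \<in> verts T" using assms by (simp add: root_nbrs_def)
  have *: "(c, v) \<in> (adj (?A \<union> edges U))\<^sup>* \<longleftrightarrow> (c, v) \<in> (adj ?A)\<^sup>* \<and> v \<in> verts T" for v
  proof
    assume "(c, v) \<in> (adj (?A \<union> edges U))\<^sup>*"
    then show "(c, v) \<in> (adj ?A)\<^sup>* \<and> v \<in> verts T"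
      using rtrancl_adj_Un_left[of c v ?A "edges U" "verts T"] c
        disj rooted_tree_edge_subset[OF T] rooted_tree_edge_subset[OF U]
      by blast
  next
    assume "(c, v) \<in> (adj ?A)\<^sup>* \<and> v \<in> verts T"
    then show "(c, v) \<in> (adj (?A \<union> edges U))\<^sup>*"
      using rtrancl_mono[OF adj_mono[of ?A "?A \<union> edges U"]] by blast
  qed
  have V: "verts (branch (graft T U) c) = verts (branch T c)"
    unfolding branch_sel graft_sel(3) edges_graft_avoiding_root * by auto
  have "verts (branch T c) \<subseteq> verts T"
    by (auto simp: branch_sel)
  then have "edges (branch (graft T U) c) = edges (branch T c)"
    unfolding branch_sel(2) V using disj roots_notin
    by (auto elim!: rooted_tree_edgeE[OF U])
  then show ?thesis
    using V by (simp add: rooted_graph.equality branch_sel(3))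
qed

lemma matula_graft: "matula (graft T U) = nth_prime (matula U) * matula T"
proof -
  have "finite (root_nbrs T)" "root U \<notin> root_nbrs T"
    using roots_notin rooted_tree_finite_verts[OF T] by (auto simp: root_nbrs_def)
  then show ?thesis
    using rooted_tree_graft T
    by (simp add: matula.simps[of "graft T U"] matula.simps[of T] root_nbrs_graft
        branch_graft_root branch_graft)
qed

end

section \<open>Pruning\<close>

text \<open>Whenever a new first vertex already occurs on the path, the path is cut back to that
  occurrence.\<close>

lemma rtrancl_distinct_path:
  assumes "(u, v) \<in> R\<^sup>*"
  obtains xs where "distinct xs" "xs \<noteq> []" "hd xs = u" "last xs = v"
    "successively (\<lambda>a b. (a, b) \<in> R) xs"
proof -
  from assms have "\<exists>xs. distinct xs \<and> xs \<noteq> [] \<and> hd xs = u \<and> last xs = v \<and>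
    successively (\<lambda>a b. (a, b) \<in> R) xs"
  proof (induction rule: converse_rtrancl_induct)
    case base
    show ?case by (rule exI[of _ "[v]"]) simp
  next
    case (step a b)
    then obtain xs where xs: "distinct xs" "xs \<noteq> []" "hd xs = b" "last xs = v"
      "successively (\<lambda>a b. (a, b) \<in> R) xs" by blast
    show ?case
    proof (cases "a \<in> set xs")
      case True
      then obtain ys zs where "xs = ys @ a # zs" by (meson split_list)
      then show ?thesis
        using xs by (intro exI[of _ "a # zs"]) (auto simp: successively_append_iff)
    next
      case False
      then show ?thesis
        using xs step by (intro exI[of _ "a # xs"]) (auto simp: successively_Cons)
    qed
  qed
  then show ?thesis using that by blast
qed

text \<open>Two neighbours of \<open>x\<close> that are joined by a walk avoiding \<open>x\<close> close up to a cycle. In a tree,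
  different neighbours of the root therefore lie in different branches.\<close>

lemma has_cycle_through:
  assumes path: "(u, v) \<in> (adj {e \<in> E. x \<notin> e})\<^sup>*" and "u \<noteq> v"
    and u: "{x, u} \<in> E" "x \<noteq> u" and v: "{x, v} \<in> E"
  shows "has_cycle E"
proof -
  obtain xs where xs: "distinct xs" "xs \<noteq> []" "hd xs = u" "last xs = v"
    "successively (\<lambda>a b. (a, b) \<in> adj {e \<in> E. x \<notin> e}) xs"
    using rtrancl_distinct_path[OF path] by blast
  have len: "length xs \<ge> 2"
    using xs(2-4) \<open>u \<noteq> v\<close> by (cases xs; cases "tl xs") auto
  have step: "{xs ! i, xs ! Suc i} \<in> E \<and> x \<notin> {xs ! i, xs ! Suc i}" if "Suc i < length xs" for i
    using xs(5) that by (simp add: successively_conv_nth)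
  have "x \<notin> set xs"
  proof
    assume "x \<in> set xs"
    then obtain i where i: "i < length xs" "xs ! i = x" by (auto simp: in_set_conv_nth)
    show False
    proof (cases "Suc i < length xs")
      case True
      then show False using step i by auto
    next
      case False
      then obtain j where "i = Suc j" using i len by (cases i) auto
      then show False using step[of j] i by auto
    qed
  qed
  moreover have "{(x # xs) ! i, (x # xs) ! (Suc i mod length (x # xs))} \<in> E"
    if "i < length (x # xs)" for i
  proof -
    show ?thesis
    proof (cases i)
      case 0
      then show ?thesis using u xs(2,3) by (simp add: hd_conv_nth)
    next
      case (Suc j)
      show ?thesis
      proof (cases "i = length xs")
        case True
        then show ?thesis using v xs(2,4) Suc by (simp add: last_conv_nth insert_commute)
      next
        case False
        then show ?thesis using step[of j] that Suc by simp
      qed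
    qed
  qed
  ultimately show ?thesis
    unfolding has_cycle_def using len xs(1) by (intro exI[of _ "x # xs"]) auto
qed

definition prune :: "'a rooted_graph \<Rightarrow> 'a \<Rightarrow> 'a rooted_graph" where
  "prune T c = (let V = verts T - verts (branch T c)
     in \<lparr>verts = V, edges = {e \<in> edges T. e \<subseteq> V}, root = root T\<rparr>)"

lemma prune_sel [simp]:
  "verts (prune T c) = verts T - verts (branch T c)"
  "edges (prune T c) = {e \<in> edges T. e \<subseteq> verts T - verts (branch T c)}"
  "root (prune T c) = root T"
  by (simp_all add: prune_def Let_def)

locale root_nbr =
  fixes T :: "'a rooted_graph" and c :: 'a
  assumes T: "rooted_tree T" and c: "c \<in> root_nbrs T"
begin

lemma c_in_branch: "c \<in> verts (branch T c)"
  using c root_notin_root_nbrs[OF T] by (auto simp: branch_sel root_nbrs_def)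

lemma branch_verts_subset: "verts (branch T c) \<subseteq> verts T - {root T}"
  by (auto simp: branch_sel)

text \<open>The edge to the root is the only one that leaves a branch: an end point other than the root would
  belong to the component, and a second edge to the root would close a cycle.\<close>

lemma boundary_edge:
  assumes "{u, v} \<in> edges T" "u \<in> verts (branch T c)" "v \<notin> verts (branch T c)"
  shows "u = c" "v = root T"
proof -
  have uv: "u \<in> verts T" "v \<in> verts T" "u \<noteq> root T"
    and path: "(c, u) \<in> (adj {e \<in> edges T. root T \<notin> e})\<^sup>*"
    using assms rooted_tree_edge_subset[OF T] by (auto simp: branch_sel)
  show v: "v = root T"
  proof (rule ccontr)
    assume "v \<noteq> root T"
    then have "(u, v) \<in> adj {e \<in> edges T. root T \<notin> e}"
      using assms uv by auto
    then have "v \<in> verts (branch T c)"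
      using path uv \<open>v \<noteq> root T\<close> by (auto simp: branch_sel intro: rtrancl_into_rtrancl)
    then show False using assms by simp
  qed
  show "u = c"
  proof (rule ccontr)
    assume "u \<noteq> c"
    moreover have "{root T, c} \<in> edges T" "root T \<noteq> c"
      using c root_notin_root_nbrs[OF T] by (auto simp: root_nbrs_def)
    moreover have "{root T, u} \<in> edges T"
      using assms(1) v by (simp add: insert_commute)
    ultimately have "has_cycle (edges T)"
      using has_cycle_through[OF path] by blast
    then show False using rooted_tree_acyclic[OF T] by simp
  qed
qed

lemma rooted_tree_branch: "rooted_tree (branch T c)"
proof (rule rooted_treeI)
  show "finite (verts (branch T c))"
    using branch_verts_subset rooted_tree_finite_verts[OF T] finite_subset by blast
  show "root (branch T c) \<in> verts (branch T c)"
    using c_in_branch by (simp add: branch_sel(3))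
  show "e \<subseteq> verts (branch T c) \<and> card e = 2" if "e \<in> edges (branch T c)" for e
    using that rooted_tree_edge_card[OF T] by (auto simp: branch_sel(2))
  show "\<not> has_cycle (edges (branch T c))"
    using rooted_tree_acyclic[OF T] has_cycle_mono[of "edges (branch T c)" "edges T"]
    by (auto simp: branch_sel(2))
  fix v assume "v \<in> verts (branch T c)"
  then have "(c, v) \<in> (adj {e \<in> edges T. root T \<notin> e})\<^sup>*"
    by (simp add: branch_sel)
  then have "(c, v) \<in> (adj (edges (branch T c)))\<^sup>* \<and> v \<in> verts (branch T c)"
  proof (induction rule: rtrancl_induct)
    case (step u v)
    then have "v \<in> verts (branch T c)"
      using boundary_edge(2)[of u v] by auto
    then have "(u, v) \<in> adj (edges (branch T c))"
      using step by (auto simp: branch_sel(2))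
    then show ?case
      using step.IH \<open>v \<in> verts (branch T c)\<close> by (auto intro: rtrancl_into_rtrancl)
  qed (use c_in_branch in simp)
  then show "(root (branch T c), v) \<in> (adj (edges (branch T c)))\<^sup>*"
    by (simp add: branch_sel(3))
qed

text \<open>A walk to the root that starts outside the branch can enter it only through the root, so up to
  its first visit to the root it is a walk in the pruned tree.\<close>

lemma rooted_tree_prune: "rooted_tree (prune T c)"
proof (rule rooted_treeI)
  show "finite (verts (prune T c))"
    using rooted_tree_finite_verts[OF T] by simp
  show root: "root (prune T c) \<in> verts (prune T c)"
    using branch_verts_subset rooted_tree_root[OF T] by auto
  show "e \<subseteq> verts (prune T c) \<and> card e = 2" if "e \<in> edges (prune T c)" for e
    using that rooted_tree_edge_card[OF T] by auto
  show "\<not> has_cycle (edges (prune T c))"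
    using rooted_tree_acyclic[OF T] has_cycle_mono[of "edges (prune T c)" "edges T"] by auto
  fix v assume v: "v \<in> verts (prune T c)"
  then have "(v, root T) \<in> (adj (edges T))\<^sup>*"
    using rooted_tree_connected[OF T _ rooted_tree_root[OF T]] by simp
  then have "(v, root T) \<in> (adj (edges (prune T c)))\<^sup>*"
    using v
  proof (induction rule: converse_rtrancl_induct)
    case (step u v)
    show ?case
    proof (cases "u = root T")
      case False
      have e: "{v, u} \<in> edges T" using step by (simp add: insert_commute)
      then have v: "v \<in> verts (prune T c)"
        using boundary_edge(2)[of v u] step.prems False rooted_tree_edge_subset[OF T e] by auto
      then have "(u, v) \<in> adj (edges (prune T c))"
        using step by auto
      then show ?thesis
        using step.IH[OF v] by (rule converse_rtrancl_into_rtrancl)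
    qed simp
  qed simp
  then show "(root (prune T c), v) \<in> (adj (edges (prune T c)))\<^sup>*"
    by (simp add: adj_rtrancl_sym)
qed

lemma graft_prune_branch: "graft (prune T c) (branch T c) = T"
proof -
  have "e = {root T, c}" if e: "e \<in> edges T" "\<not> e \<subseteq> verts (branch T c)"
    "\<not> e \<subseteq> verts T - verts (branch T c)" for e
  proof -
    obtain u v where uv: "e = {u, v}" "u \<in> verts T" "v \<in> verts T"
      using e(1) by (auto elim: rooted_tree_edgeE[OF T])
    then have "u \<in> verts (branch T c) \<and> v \<notin> verts (branch T c) \<or>
      v \<in> verts (branch T c) \<and> u \<notin> verts (branch T c)"
      using e by auto
    then show ?thesis
    proof
      assume "u \<in> verts (branch T c) \<and> v \<notin> verts (branch T c)"
      then have "u = c" "v = root T"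
        using boundary_edge[of u v] uv(1) e(1) by blast+
      then show ?thesis using uv(1) by auto
    next
      assume "v \<in> verts (branch T c) \<and> u \<notin> verts (branch T c)"
      then have "v = c" "u = root T"
        using boundary_edge[of v u] uv(1) e(1) by (auto simp: insert_commute[of v u])
      then show ?thesis using uv(1) by auto
    qed
  qed
  then have "edges (graft (prune T c) (branch T c)) = edges T"
    using c by (auto simp: branch_sel(2,3) root_nbrs_def)
  then show ?thesis
    using branch_verts_subset by (auto intro!: rooted_graph.equality)
qed

lemma graftable: "graftable (prune T c) (branch T c)"
  using rooted_tree_prune rooted_tree_branch by unfold_locales auto

end

lemma trivial_tree:
  assumes T: "rooted_tree T" and "root_nbrs T = {}"
  shows "verts T = {root T}" "edges T = {}"
proof -
  have no_edge: "{root T, c} \<notin> edges T" for c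
    using assms(2) root_nbrs_iff[OF T, of c] by blast
  have "v = root T" if "v \<in> verts T" for v
    using rooted_tree_connected[OF T rooted_tree_root[OF T] that]
    by (rule converse_rtranclE) (simp_all add: no_edge)
  then show "verts T = {root T}"
    using rooted_tree_root[OF T] by blast
  then have "e \<notin> edges T" for e
    using rooted_tree_edge_subset[OF T, of e] rooted_tree_edge_card[OF T, of e]
    by (auto simp: subset_singleton_iff)
  then show "edges T = {}" by blast
qed

text \<open>Induction on the number of vertices: both parts into which a branch splits the tree are
  nonempty.\<close>

lemma rooted_tree_induct [consumes 1, case_names trivial graft]:
  assumes "rooted_tree T"
    and triv: "\<And>T. rooted_tree T \<Longrightarrow> root_nbrs T = {} \<Longrightarrow> P T"
    and graft: "\<And>T U. graftable T U \<Longrightarrow> P T \<Longrightarrow> P U \<Longrightarrow> P (graft T U)"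
  shows "P T"
  using assms(1)
proof (induction "card (verts T)" arbitrary: T rule: less_induct)
  case less
  show ?case
  proof (cases "root_nbrs T = {}")
    case False
    then obtain c where "c \<in> root_nbrs T" by blast
    then interpret root_nbr T c using less by unfold_locales auto
    have "verts (branch T c) \<subset> verts T" "verts (prune T c) \<subset> verts T"
      using branch_verts_subset c_in_branch rooted_tree_root[OF T] by auto
    then have "P (prune T c)" "P (branch T c)"
      using less rooted_tree_prune rooted_tree_branch
      by (auto intro!: less.hyps psubset_card_mono rooted_tree_finite_verts)
    then show ?thesis
      using graft[OF graftable] by (simp add: graft_prune_branch)
  qed (use triv less in auto)
qed

section \<open>Prime indices and prime factors\<close>

lemma prime_nth_prime: "prime (nth_prime m)"
  using enumerate_in_set[OF primes_infinite] by (simp add: nth_prime_def)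

lemma nth_prime_inj:
  assumes "nth_prime s = nth_prime t" "s \<ge> 1" "t \<ge> 1"
  shows "s = t"
proof -
  have "s - 1 = t - 1"
    using assms(1) strict_mono_enumerate[OF primes_infinite]
    by (simp add: nth_prime_def strict_mono_eq)
  then show ?thesis using assms by simp
qed

lemma nth_prime_surj:
  assumes "prime p"
  obtains t where "t \<ge> 1" "p = nth_prime t"
proof -
  obtain k where "enumerate {p::nat. prime p} k = p"
    using enumerate_Ex[of "{p::nat. prime p}" p] primes_infinite assms by auto
  then show ?thesis
    using that[of "Suc k"] by (simp add: nth_prime_def)
qed

lemma less_nth_prime: "t \<ge> 1 \<Longrightarrow> t < nth_prime t"
proof (induction t rule: nat_induct_at_least)
  case base
  show ?case using prime_gt_1_nat[OF prime_nth_prime] by simp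
next
  case (Suc t)
  have "nth_prime t < nth_prime (Suc t)"
    using Suc.hyps strict_monoD[OF strict_mono_enumerate[OF primes_infinite], of "t - 1" t]
    by (simp add: nth_prime_def)
  then show ?case using Suc by linarith
qed

text \<open>The arithmetic counterpart of \<open>rooted_tree_induct\<close>; besides \<open>m < p\<^sub>t m\<close> it rests on \<open>t < p\<^sub>t\<close>.\<close>

lemma matula_number_induct [consumes 1, case_names one nth_prime]:
  assumes "n \<ge> 1" and one: "P 1"
    and nth_prime: "\<And>t m. t \<ge> 1 \<Longrightarrow> m \<ge> 1 \<Longrightarrow> P t \<Longrightarrow> P m \<Longrightarrow> P (nth_prime t * m)"
  shows "P n"
  using assms(1)
proof (induction n rule: less_induct)
  case (less n)
  show ?case
  proof (cases "n = 1")
    case False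
    then obtain p m where p: "prime p" and n: "n = p * m"
      using prime_factor_nat[of n] by (auto elim: dvdE)
    obtain t where t: "t \<ge> 1" "p = nth_prime t" using nth_prime_surj[OF p] .
    have m: "m \<ge> 1" using less.prems n by (cases m) auto
    have "m < n" using m n prime_gt_1_nat[OF p] by simp
    moreover have "p * 1 \<le> n" unfolding n using m by (rule mult_le_mono2)
    then have "t < n" using less_nth_prime[OF t(1)] t(2) by simp
    ultimately show ?thesis
      using nth_prime[OF t(1) m] less.IH t m n by blast
  qed (use one in simp)
qed

lemma big_Omega_1 [simp]: "big_Omega (Suc 0) = 0"
  by (simp add: big_Omega_def)

lemma big_Omega_mult: "r \<noteq> 0 \<Longrightarrow> s \<noteq> 0 \<Longrightarrow> big_Omega (r * s) = big_Omega r + big_Omega s"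
  by (simp add: big_Omega_def prime_factorization_mult)

lemma big_Omega_nth_prime: "big_Omega (nth_prime t) = 1"
  by (simp add: big_Omega_def prime_factorization_prime prime_nth_prime)

section \<open>Tree statistics under grafting\<close>

lemma level_eq_1_iff:
  assumes T: "rooted_tree T" and v: "v \<in> verts T"
  shows "level T v = 1 \<longleftrightarrow> v \<in> root_nbrs T"
proof -
  obtain k where "(root T, v) \<in> adj (edges T) ^^ k"
    using rooted_tree_connected[OF T rooted_tree_root[OF T] v] rtrancl_power by blast
  then have least: "(root T, v) \<in> adj (edges T) ^^ level T v"
    unfolding level_def by (rule LeastI)
  show ?thesis
  proof
    assume "level T v = 1"
    then show "v \<in> root_nbrs T"
      using least v by (simp add: root_nbrs_def)
  next
    assume v: "v \<in> root_nbrs T"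
    then have "v \<noteq> root T" using root_notin_root_nbrs[OF T] by blast
    then have "level T v \<noteq> 0" using least by (intro notI) simp
    moreover have "level T v \<le> 1"
      unfolding level_def using v by (intro Least_le) (simp add: root_nbrs_def)
    ultimately show "level T v = 1" by simp
  qed
qed

lemma level1_degrees_eq:
  assumes "rooted_tree T"
  shows "level1_degrees T = (\<Sum>v\<in>root_nbrs T. deg T v)"
proof -
  have "{v \<in> verts T. level T v = 1} = root_nbrs T"
    using level_eq_1_iff[OF assms] by (auto simp: root_nbrs_def)
  then show ?thesis by (simp add: level1_degrees_def)
qed

lemma root_edges:
  assumes T: "rooted_tree T"
  shows "bij_betw (\<lambda>v. {root T, v}) (root_nbrs T) {e \<in> edges T. root T \<in> e}"
proof -
  have inj: "inj_on (\<lambda>v. {root T, v}) (root_nbrs T)"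
    by (auto simp: inj_on_def doubleton_eq_iff)
  have "e \<in> (\<lambda>v. {root T, v}) ` root_nbrs T" if e: "e \<in> edges T" "root T \<in> e" for e
  proof -
    obtain v where "e = {root T, v}"
      using e by (blast elim: rooted_tree_edgeE[OF T])
    then show ?thesis
      using e by (auto simp: root_nbrs_iff[OF T])
  qed
  then have image: "(\<lambda>v. {root T, v}) ` root_nbrs T = {e \<in> edges T. root T \<in> e}"
    by (auto simp: root_nbrs_def)
  with inj show ?thesis by (simp add: bij_betw_def)
qed

text \<open>The effect of one more edge at the root on the old edges. The edge from the root to \<open>v\<close> now counts
  \<open>(deg (root T) + 1) * deg T v\<close>, a gain of \<open>deg T v\<close>, and the gains add up to the level-1 degree
  sum. The degrees \<open>d\<close> are kept abstract because the lemma serves both parts of a graft.\<close>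

lemma zagreb2_raised_root:
  assumes T: "rooted_tree T"
    and d: "d (root T) = deg T (root T) + 1"
      "\<And>v. v \<in> verts T \<Longrightarrow> v \<noteq> root T \<Longrightarrow> d v = deg T v"
  shows "(\<Sum>e\<in>edges T. \<Prod>v\<in>e. d v) = zagreb2 T + level1_degrees T"
proof -
  let ?x = "root T"
  let ?R = "{e \<in> edges T. ?x \<in> e}" and ?N = "{e \<in> edges T. ?x \<notin> e}"
  have split: "sum f (edges T) = sum f ?R + sum f ?N" for f :: "'a set \<Rightarrow> nat"
    using sum.Int_Diff[OF rooted_tree_finite_edges[OF T], of f "{e. ?x \<in> e}"]
    by (simp add: Int_def set_diff_eq)
  have root: "sum f ?R = (\<Sum>v\<in>root_nbrs T. f {?x, v})" for f :: "'a set \<Rightarrow> nat"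
    using sum.reindex_bij_betw[OF root_edges[OF T], of f] by simp
  have "(\<Sum>e\<in>?N. \<Prod>v\<in>e. d v) = (\<Sum>e\<in>?N. \<Prod>v\<in>e. deg T v)"
    using rooted_tree_edge_subset[OF T] by (intro sum.cong prod.cong refl d(2)) auto
  moreover have "(\<Sum>v\<in>root_nbrs T. \<Prod>u\<in>{?x, v}. d u) =
      (\<Sum>v\<in>root_nbrs T. \<Prod>u\<in>{?x, v}. deg T u) + level1_degrees T"
    unfolding level1_degrees_eq[OF T] sum.distrib[symmetric]
  proof (rule sum.cong[OF refl])
    fix v assume v: "v \<in> root_nbrs T"
    then have "v \<noteq> ?x" "v \<in> verts T"
      using root_notin_root_nbrs[OF T] by (auto simp: root_nbrs_def)
    then show "(\<Prod>u\<in>{?x, v}. d u) = (\<Prod>u\<in>{?x, v}. deg T u) + deg T v"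
      using d by simp
  qed
  ultimately show ?thesis
    unfolding zagreb2_def split root by simp
qed

context graftable
begin

lemma deg_graft:
  shows "v \<in> verts T \<Longrightarrow> deg (graft T U) v = deg T v + of_bool (v = root T)"
    and "v \<in> verts U \<Longrightarrow> deg (graft T U) v = deg U v + of_bool (v = root U)"
proof -
  have fin: "finite {e \<in> edges T. v \<in> e}" "finite {e \<in> edges U. v \<in> e}" for v
    using rooted_tree_finite_edges[OF T] rooted_tree_finite_edges[OF U] by auto
  show "deg (graft T U) v = deg T v + of_bool (v = root T)" if "v \<in> verts T"
  proof -
    have "{e \<in> edges (graft T U). v \<in> e} =
      (if v = root T then insert {root T, root U} {e \<in> edges T. v \<in> e} else {e \<in> edges T. v \<in> e})"
      using that disj roots_notin rooted_tree_edge_subset[OF U] by auto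
    then show ?thesis using fin edges_disjoint by (simp add: deg_def)
  qed
  show "deg (graft T U) v = deg U v + of_bool (v = root U)" if "v \<in> verts U"
  proof -
    have "{e \<in> edges (graft T U). v \<in> e} =
      (if v = root U then insert {root T, root U} {e \<in> edges U. v \<in> e} else {e \<in> edges U. v \<in> e})"
      using that disj roots_notin rooted_tree_edge_subset[OF T] by auto
    then show ?thesis using fin edges_disjoint by (simp add: deg_def)
  qed
qed

lemma level1_degrees_graft:
  "level1_degrees (graft T U) = level1_degrees T + deg U (root U) + 1"
proof -
  have "finite (root_nbrs T)" "root U \<notin> root_nbrs T"
    using roots_notin rooted_tree_finite_verts[OF T] by (auto simp: root_nbrs_def)
  moreover have "deg (graft T U) v = deg T v" if "v \<in> root_nbrs T" for v
    using that deg_graft(1)[of v] root_notin_root_nbrs[OF T] by (auto simp: root_nbrs_def)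
  ultimately show ?thesis
    using deg_graft(2)[OF rooted_tree_root[OF U]]
    by (simp add: level1_degrees_eq[OF T] level1_degrees_eq[OF rooted_tree_graft] root_nbrs_graft)
qed

lemma zagreb2_graft:
  "zagreb2 (graft T U) = zagreb2 T + level1_degrees T + zagreb2 U + level1_degrees U +
     (deg T (root T) + 1) * (deg U (root U) + 1)"
proof -
  let ?d = "deg (graft T U)"
  have "zagreb2 (graft T U) = (\<Prod>v\<in>{root T, root U}. ?d v) +
      ((\<Sum>e\<in>edges T. \<Prod>v\<in>e. ?d v) + (\<Sum>e\<in>edges U. \<Prod>v\<in>e. ?d v))"
    using edges_disjoint rooted_tree_finite_edges[OF T] rooted_tree_finite_edges[OF U]
    by (simp add: zagreb2_def sum.union_disjoint)
  also have "(\<Sum>e\<in>edges T. \<Prod>v\<in>e. ?d v) = zagreb2 T + level1_degrees T"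
    by (rule zagreb2_raised_root[OF T]) (simp_all add: deg_graft rooted_tree_root[OF T])
  also have "(\<Sum>e\<in>edges U. \<Prod>v\<in>e. ?d v) = zagreb2 U + level1_degrees U"
    by (rule zagreb2_raised_root[OF U]) (simp_all add: deg_graft rooted_tree_root[OF U])
  finally show ?thesis
    using root_neq by (simp add: deg_graft rooted_tree_root[OF T] rooted_tree_root[OF U])
qed

end

section \<open>Matula numbers determine statistics\<close>

lemma matula_trivial: "rooted_tree T \<Longrightarrow> root_nbrs T = {} \<Longrightarrow> matula T = 1"
  by (simp add: matula.simps)

lemma matula_pos: "rooted_tree T \<Longrightarrow> matula T \<ge> 1"
  by (induction rule: rooted_tree_induct)
    (simp_all add: matula_trivial graftable.matula_graft Suc_le_eq prime_gt_0_nat prime_nth_prime)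

lemma trivial_statistics:
  assumes "rooted_tree T" "root_nbrs T = {}"
  shows "zagreb2 T = 0" "level1_degrees T = 0" "deg T v = 0"
  using trivial_tree[OF assms] assms
  by (simp_all add: zagreb2_def deg_def level1_degrees_eq)

lemma deg_root_eq_big_Omega:
  assumes "rooted_tree T"
  shows "deg T (root T) = big_Omega (matula T)"
  using assms
proof (induction rule: rooted_tree_induct)
  case (graft T U)
  then interpret graftable T U by simp
  have "nth_prime (matula U) \<noteq> 0" "matula T \<noteq> 0"
    using matula_pos[OF T] prime_gt_0_nat[OF prime_nth_prime] by auto
  then show ?case
    using graft deg_graft(1)[OF rooted_tree_root[OF T]]
    by (simp add: matula_graft big_Omega_mult big_Omega_nth_prime)
qed (simp add: matula_trivial trivial_statistics)

text \<open>Induction over grafts. If \<open>T'\<close> has the same Matula number \<open>p\<^sub>t m\<close> as a graft of \<open>U\<close> onto \<open>T\<close>, then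
  \<open>p\<^sub>t\<close> divides the product over the branches of \<open>T'\<close>, so it is the factor of one of them. That branch
  has Matula number \<open>t\<close>, the rest of \<open>T'\<close> has Matula number \<open>m\<close>, and the induction hypotheses apply
  to these two pieces. The statistic \<open>S\<close> may have several components, which matters when the
  recursion of one involves another.\<close>

lemma matula_determines_statistic:
  assumes triv: "\<And>T T'. rooted_tree T \<Longrightarrow> rooted_tree T' \<Longrightarrow> root_nbrs T = {} \<Longrightarrow>
      root_nbrs T' = {} \<Longrightarrow> S T = S T'"
    and graft: "\<And>T U. graftable T U \<Longrightarrow> S (graft T U) = F (S T) (S U)"
    and "rooted_tree T" "rooted_tree T'" "matula T = matula T'"
  shows "S T = S T'"
  using assms(3-5)
proof (induction arbitrary: T' rule: rooted_tree_induct)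
  case (trivial T)
  have "root_nbrs T' = {}"
  proof (rule ccontr)
    assume "root_nbrs T' \<noteq> {}"
    then obtain c where "c \<in> root_nbrs T'" by blast
    then interpret c: root_nbr T' c using trivial by unfold_locales auto
    have "matula T' = nth_prime (matula (branch T' c)) * matula (prune T' c)"
      using graftable.matula_graft[OF c.graftable] c.graft_prune_branch by simp
    then show False
      using trivial prime_nth_prime[of "matula (branch T' c)"] by (auto simp: matula_trivial)
  qed
  then show ?case using triv trivial by blast
next
  case (graft T U)
  interpret graftable T U by fact
  let ?p = "nth_prime (matula U)"
  have T': "rooted_tree T'" by fact
  have eq: "matula T' = ?p * matula T"
    using graft matula_graft by simp
  have "finite (root_nbrs T')"
    using rooted_tree_finite_verts[OF T'] by (simp add: root_nbrs_def)
  moreover have "?p dvd (\<Prod>c\<in>root_nbrs T'. nth_prime (matula (branch T' c)))"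
    using eq T' by (simp add: matula.simps[of T'])
  ultimately obtain c where c: "c \<in> root_nbrs T'" "?p dvd nth_prime (matula (branch T' c))"
    using prime_dvd_prod_iff[of "root_nbrs T'" ?p] prime_nth_prime by auto
  interpret c: root_nbr T' c using T' c by unfold_locales auto
  have "?p = nth_prime (matula (branch T' c))"
    using c primes_dvd_imp_eq prime_nth_prime by blast
  then have U': "matula U = matula (branch T' c)"
    using nth_prime_inj matula_pos[OF U] matula_pos[OF c.rooted_tree_branch] by blast
  have "?p * matula T = ?p * matula (prune T' c)"
    using eq U' graftable.matula_graft[OF c.graftable] c.graft_prune_branch by simp
  then have "matula T = matula (prune T' c)"
    using prime_gt_0_nat[OF prime_nth_prime[of "matula U"]] by simp
  then have "S T = S (prune T' c)" "S U = S (branch T' c)"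
    using graft.IH c.rooted_tree_prune c.rooted_tree_branch U' by blast+
  then show ?case
    using assms(2)[OF c.graftable] assms(2)[OF graft.hyps] c.graft_prune_branch by simp
qed

lemma single_vertex_tree:
  "rooted_tree \<lparr>verts = {x}, edges = {}, root = x\<rparr>"
  "root_nbrs \<lparr>verts = {x}, edges = {}, root = x\<rparr> = {}"
proof -
  have "\<not> has_cycle {}"
    unfolding has_cycle_def by (auto intro!: exI[of _ 0])
  then show "rooted_tree \<lparr>verts = {x}, edges = {}, root = x\<rparr>"
    by (intro rooted_treeI) auto
qed (simp add: root_nbrs_def)

text \<open>Asking for the tree inside a prescribed infinite set makes disjoint copies available: the finitely
  many vertices already in use can be excluded.\<close>

lemma matula_surj:
  assumes "n \<ge> 1" "infinite (S :: 'a set)"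
  shows "\<exists>T. rooted_tree T \<and> verts T \<subseteq> S \<and> matula T = n"
  using assms
proof (induction arbitrary: S rule: matula_number_induct)
  case one
  then obtain x where "x \<in> S" by fastforce
  then show ?case
    using single_vertex_tree[of x] matula_trivial
    by (intro exI[of _ "\<lparr>verts = {x}, edges = {}, root = x\<rparr>"]) auto
next
  case (nth_prime t m)
  then obtain T where repT: "rooted_tree T" "verts T \<subseteq> S" "matula T = m" by blast
  then have "infinite (S - verts T)"
    using Diff_infinite_finite[OF rooted_tree_finite_verts[OF repT(1)]] nth_prime.prems by blast
  then obtain U where repU: "rooted_tree U" "verts U \<subseteq> S - verts T" "matula U = t"
    using nth_prime by blast
  then interpret graftable T U using repT by unfold_locales auto
  show ?case
    using repT repU rooted_tree_graft matula_graft by (intro exI[of _ "graft T U"]) auto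
qed

section \<open>Recursion in the Matula number\<close>

lemma tau_represents:
  assumes "n \<ge> 1"
  shows "rooted_tree (tau n)" "matula (tau n) = n"
  using someI_ex[of "\<lambda>T. rooted_tree T \<and> matula T = n"] matula_surj[OF assms, of UNIV]
  unfolding tau_def by auto

lemma statistics_eq:
  fixes T :: "nat rooted_graph"
  assumes "rooted_tree T"
  shows "zagreb2 T = Z2 (matula T)" "level1_degrees T = A1 (matula T)"
proof -
  let ?S = "\<lambda>T :: nat rooted_graph. (zagreb2 T, level1_degrees T, deg T (root T))"
  let ?F = "\<lambda>(z, a, d) (z', a', d'). (z + a + z' + a' + (d + 1) * (d' + 1), a + d' + 1, d + 1)"
  \<comment> \<open>The root degree is included because the recursions for the other two components use it.\<close>
  have "?S T = ?S (tau (matula T))"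
  proof (rule matula_determines_statistic[where S = ?S and F = ?F])
    show "?S (graft T U) = ?F (?S T) (?S U)" if "graftable T U" for T U
      using that rooted_tree_root[OF graftable.T[OF that]]
      by (simp add: graftable.zagreb2_graft graftable.level1_degrees_graft graftable.deg_graft(1))
  qed (use assms tau_represents[OF matula_pos[OF assms]] in \<open>simp_all add: trivial_statistics\<close>)
  then show "zagreb2 T = Z2 (matula T)" "level1_degrees T = A1 (matula T)"
    by (simp_all add: Z2_def A1_def)
qed

lemma Z2_A1_1: "Z2 1 = 0" "A1 1 = 0"
  using statistics_eq[OF single_vertex_tree(1)[of 0]]
    trivial_statistics[OF single_vertex_tree[of "0::nat"]]
    matula_trivial[OF single_vertex_tree[of "0::nat"]] by simp_all

text \<open>Represent \<open>m\<close> and \<open>t\<close> by disjoint trees; their graft represents \<open>p\<^sub>t m\<close>.\<close>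

lemma Z2_A1_nth_prime_mult:
  assumes "t \<ge> 1" "m \<ge> 1"
  shows "Z2 (nth_prime t * m) =
      Z2 m + A1 m + Z2 t + A1 t + (big_Omega m + 1) * (big_Omega t + 1)"
    and "A1 (nth_prime t * m) = A1 m + big_Omega t + 1"
proof -
  have inf: "infinite (UNIV :: nat set)" by simp
  obtain T :: "nat rooted_graph" where repT: "rooted_tree T" "matula T = m"
    using matula_surj[OF assms(2) inf] by blast
  then have "infinite (UNIV - verts T)"
    using Diff_infinite_finite[OF rooted_tree_finite_verts inf] by blast
  then obtain U where repU: "rooted_tree U" "verts U \<subseteq> UNIV - verts T" "matula U = t"
    using matula_surj[OF assms(1)] by blast
  interpret graftable T U using repT repU by unfold_locales auto
  have tree: "rooted_tree (graft T U)" and mu: "matula (graft T U) = nth_prime t * m"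
    using rooted_tree_graft matula_graft repT repU by simp_all
  show "Z2 (nth_prime t * m) =
      Z2 m + A1 m + Z2 t + A1 t + (big_Omega m + 1) * (big_Omega t + 1)"
    using zagreb2_graft statistics_eq[OF tree] statistics_eq[OF repT(1)] statistics_eq[OF repU(1)]
      deg_root_eq_big_Omega[OF repT(1)] deg_root_eq_big_Omega[OF repU(1)]
    unfolding mu repT(2) repU(3) by metis
  show "A1 (nth_prime t * m) = A1 m + big_Omega t + 1"
    using level1_degrees_graft statistics_eq[OF tree] statistics_eq[OF repT(1)]
      deg_root_eq_big_Omega[OF repU(1)]
    unfolding mu repT(2) repU(3) by metis
qed

text \<open>Splitting off the prime factors of \<open>r\<close> one at a time. The additivity of \<open>A1\<close> is carried along because
  the recursion for \<open>Z2 (p\<^sub>t (m s))\<close> involves \<open>A1 (m s)\<close>.\<close>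

lemma Z2_A1_mult:
  assumes "r \<ge> 1" "s \<ge> 1"
  shows "Z2 (r * s) = Z2 r + Z2 s + A1 r * big_Omega s + A1 s * big_Omega r \<and>
    A1 (r * s) = A1 r + A1 s"
  using assms
proof (induction rule: matula_number_induct)
  case one
  then show ?case using Z2_A1_1 by simp
next
  case (nth_prime t m)
  let ?p = "nth_prime t"
  have pos: "m * s \<ge> 1" "m \<noteq> 0" "s \<noteq> 0" "?p \<noteq> 0"
    using nth_prime prime_gt_0_nat[OF prime_nth_prime[of t]] by auto
  have Omega: "big_Omega (m * s) = big_Omega m + big_Omega s"
    "big_Omega (?p * m) = big_Omega m + 1"
    using pos by (simp_all add: big_Omega_mult big_Omega_nth_prime)
  have IH: "Z2 (m * s) = Z2 m + Z2 s + A1 m * big_Omega s + A1 s * big_Omega m"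
    "A1 (m * s) = A1 m + A1 s"
    using nth_prime by auto
  note rec = Z2_A1_nth_prime_mult[OF \<open>t \<ge> 1\<close> \<open>m \<ge> 1\<close>]
    Z2_A1_nth_prime_mult[OF \<open>t \<ge> 1\<close> \<open>m * s \<ge> 1\<close>]
  show ?case
    unfolding mult.assoc[of ?p m s] rec Omega IH by (simp add: algebra_simps)
qed

theorem proposition3p20:
  fixes n :: nat
  assumes "n \<ge> 1"
  shows "(n = 1 \<longrightarrow> Z2 n = 0) \<and>
         (\<forall>t\<ge>1. n = nth_prime t \<longrightarrow> Z2 n = Z2 t + A1 t + big_Omega t + 1) \<and>
         (\<forall>r s. r \<ge> 2 \<and> s \<ge> 2 \<and> n = r * s \<longrightarrow>
            Z2 n = Z2 r + Z2 s + A1 r * big_Omega s + A1 s * big_Omega r)"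
  using Z2_A1_1 Z2_A1_nth_prime_mult[of _ 1] Z2_A1_mult by auto

end
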